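(* Let $D(t)\in\mathbb{C}[t]$ be a nonconstant Pellian polynomial. Then there are only finitely many integers $n\geq1$ for which $v^{\mathrm{new}}_n(t)$ has a repeated factor over $\mathbb{C}[t]$ (equivalently, a root in $\mathbb{C}$ of multiplicity at least $2$).
   Context: Pell's equation for a nonconstant $D\in\mathbb{C}[t]$ is $x^2-Dy^2=1$ with $x,y\in\mathbb{C}[t]$. $D$ is called Pellian if it has a solution with $y\neq0$. A fundamental solution is a solution $(u,v)$ with $v\neq 0$ of minimal degree among all solutions with $y\neq0$. For integers $n\geq 1$ define $u_n,v_n$ by $u_n+v_n\sqrt{D}=(u+v\sqrt{D})^n$. The "new part" $v^{\mathrm{new}}_n$ of $v_n$ is the polynomial determined by $v_n=\prod_{m\mid n}v^{\mathrm{new}}_m$ for all $n\geq 1$; equivalently $v^{\mathrm{new}}_n=\prod_{m\mid n}v_m^{\mu(n/m)}$, where $\mu$ is the Möbius function. *)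

theory Defs
  imports "HOL-Computational_Algebra.Computational_Algebra" "HOL-Number_Theory.Totient"
begin

definition pell_solution :: "complex poly \<Rightarrow> complex poly \<Rightarrow> complex poly \<Rightarrow> bool" where
  "pell_solution D x y \<longleftrightarrow> x\<^sup>2 - D * y\<^sup>2 = 1"

definition pellian :: "complex poly \<Rightarrow> bool" where
  "pellian D \<longleftrightarrow> (\<exists>x y. pell_solution D x y \<and> y \<noteq> 0)"

(* The degree of a solution (x, y) is the degree of x. For nonconstant D and y \<noteq> 0 one has
   2 * degree x = degree D + 2 * degree y, so minimizing degree y selects the same solutions. *)
definition pell_fundamental :: "complex poly \<Rightarrow> complex poly \<Rightarrow> complex poly \<Rightarrow> bool" where
  "pell_fundamental D u v \<longleftrightarrow>
     pell_solution D u v \<and> v \<noteq> 0 \<and>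
     (\<forall>x y. pell_solution D x y \<and> y \<noteq> 0 \<longrightarrow> degree u \<le> degree x)"

(* The pair (a, b) stands for a + b * sqrt D, so pell_power D u v n is (u + v * sqrt D) ^ n. *)
primrec pell_power ::
  "complex poly \<Rightarrow> complex poly \<Rightarrow> complex poly \<Rightarrow> nat \<Rightarrow> complex poly \<times> complex poly" where
  "pell_power D u v 0 = (1, 0)"
| "pell_power D u v (Suc n) =
     (case pell_power D u v n of (a, b) \<Rightarrow> (u * a + D * v * b, u * b + v * a))"

definition pell_u :: "complex poly \<Rightarrow> complex poly \<Rightarrow> complex poly \<Rightarrow> nat \<Rightarrow> complex poly" where
  "pell_u D u v n = fst (pell_power D u v n)"

definition pell_v :: "complex poly \<Rightarrow> complex poly \<Rightarrow> complex poly \<Rightarrow> nat \<Rightarrow> complex poly" where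
  "pell_v D u v n = snd (pell_power D u v n)"

(* The index 0 carries no meaning; the value there is fixed only to make the sequence unique.
   Existence and uniqueness are pell_v_new_exists and pell_v_new_unique below. *)
definition pell_v_new :: "complex poly \<Rightarrow> complex poly \<Rightarrow> complex poly \<Rightarrow> nat \<Rightarrow> complex poly" where
  "pell_v_new D u v =
     (THE w. w 0 = 0 \<and> (\<forall>n\<ge>1. pell_v D u v n = (\<Prod>m | m dvd n. w m)))"

lemma pell_0 [simp]: "pell_u D u v 0 = 1" "pell_v D u v 0 = 0"
  by (simp_all add: pell_u_def pell_v_def)

lemma pell_Suc:
  "pell_u D u v (Suc n) = u * pell_u D u v n + D * v * pell_v D u v n"
  "pell_v D u v (Suc n) = u * pell_v D u v n + v * pell_u D u v n"
  by (simp_all add: pell_u_def pell_v_def split: prod.split)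

(* The defining relation u_n + v_n * sqrt D = (u + v * sqrt D) ^ n, read in C[t][X] / (X^2 - D). *)
lemma pell_power_cong:
  "[: - D, 0, 1 :] dvd [: u, v :] ^ n - [: pell_u D u v n, pell_v D u v n :]"
proof (induction n)
  case 0
  show ?case by (simp add: one_pCons)
next
  case (Suc n)
  let ?a = "pell_u D u v n" and ?b = "pell_v D u v n"
  have "[:u, v:] ^ Suc n - [:pell_u D u v (Suc n), pell_v D u v (Suc n):] =
        [:u, v:] * ([:u, v:] ^ n - [:?a, ?b:]) + [: - D, 0, 1 :] * [: v * ?b :]"
    by (simp add: pell_Suc algebra_simps)
  then show ?case
    using Suc.IH by (metis dvd_add dvd_mult dvd_triv_left)
qed

fun cheb :: "nat \<Rightarrow> complex poly" where
  "cheb 0 = 0"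
| "cheb (Suc 0) = 1"
| "cheb (Suc (Suc n)) = [:0, 2:] * cheb (Suc n) - cheb n"

lemma pell_v_cheb:
  assumes "pell_solution D u v"
  shows "pell_v D u v n = v * pcompose (cheb n) u"
proof (induction n rule: cheb.induct)
  case (3 n)
  have D: "D * v * v = u * u - 1"
    using assms by (simp add: pell_solution_def power2_eq_square algebra_simps)
  have "pell_v D u v (Suc (Suc n)) =
      u * pell_v D u v (Suc n) + u * (v * pell_u D u v n) + (D * v * v) * pell_v D u v n"
    by (simp add: pell_Suc algebra_simps)
  also have "\<dots> = 2 * u * pell_v D u v (Suc n) - pell_v D u v n"
    unfolding D by (simp add: pell_Suc algebra_simps)
  finally show ?case
    unfolding 3
    by (simp add: pcompose_diff pcompose_smult pcompose_pCons numeral_mult_conv_smult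
        right_diff_distrib mult.left_commute mult.assoc)
qed (simp_all add: pell_Suc pcompose_1)

lemma cheb_sin: "poly (cheb n) (of_real (cos x)) * of_real (sin x) = of_real (sin (real n * x))"
proof (induction n rule: cheb.induct)
  case (3 n)
  have s: "sin (real (Suc (Suc n)) * x) = 2 * cos x * sin (real (Suc n) * x) - sin (real n * x)"
    using sin_times_cos[of "real (Suc n) * x" x] by (simp add: algebra_simps)
  have "poly (cheb (Suc (Suc n))) (of_real (cos x)) * of_real (sin x) =
     2 * of_real (cos x) * (poly (cheb (Suc n)) (of_real (cos x)) * of_real (sin x)) -
     poly (cheb n) (of_real (cos x)) * of_real (sin x)"
    by (simp add: algebra_simps)
  then show ?case unfolding 3 s by simp
qed simp_all

lemma cheb_degree: "degree (cheb (Suc n)) = n \<and> coeff (cheb (Suc n)) n = 2 ^ n"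
proof (induction n rule: less_induct)
  case (less n)
  consider "n = 0" | "n = 1" | m where "n = Suc (Suc m)"
    by (metis One_nat_def old.nat.exhaust)
  then show ?case
  proof cases
    case (3 m)
    have a: "degree (cheb (Suc (Suc m))) = Suc m" "coeff (cheb (Suc (Suc m))) (Suc m) = 2 ^ Suc m"
      and b: "degree (cheb (Suc m)) = m"
      using less.IH[of "Suc m"] less.IH[of m] 3 by auto
    have c: "coeff (cheb (Suc m)) (Suc (Suc m)) = 0"
      using b by (intro coeff_eq_0) simp
    have d: "coeff (cheb (Suc n)) n = 2 ^ n"
      using a c 3 by (simp add: mult_pCons_left)
    have "degree ([:0, 2:] * cheb (Suc (Suc m))) \<le> Suc (Suc m)"
      using degree_mult_le[of "[:0, 2:]" "cheb (Suc (Suc m))"] a by simp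
    then have "degree (cheb (Suc n)) \<le> n"
      unfolding 3 cheb.simps(3)[of "Suc m"] using b by (intro degree_diff_le) auto
    moreover have "n \<le> degree (cheb (Suc n))"
      using d by (intro le_degree) simp
    ultimately show ?thesis using d by simp
  qed (simp_all)
qed

lemma cheb_prod:
  fixes n :: nat
  assumes "n \<ge> 1"
  shows "cheb n = (\<Prod>j = 1..<n. [: of_real (- 2 * cos (real j / real n * pi)), 2 :])" (is "_ = ?R")
proof -
  obtain k where n: "n = Suc k" using assms by (cases n) auto
  define c where "c j = complex_of_real (cos (real j / real n * pi))" for j :: nat
  have inj: "inj_on c {1..<n}"
  proof (rule inj_onI)
    fix i j assume ij: "i \<in> {1..<n}" "j \<in> {1..<n}" "c i = c j"
    have range: "0 \<le> real l / real n * pi \<and> real l / real n * pi \<le> pi"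
      if "l \<in> {1..<n}" for l
      using that mult_right_mono[of "real l / real n" 1 pi] by simp
    have "cos (real i / real n * pi) = cos (real j / real n * pi)"
      using ij(3) unfolding c_def of_real_eq_iff .
    then have "real i / real n * pi = real j / real n * pi"
      using range[OF ij(1)] range[OF ij(2)] cos_inj_pi by blast
    then show "i = j" using assms by simp
  qed
  have R: "?R = smult (2 ^ k) (\<Prod>j = 1..<n. [: - c j, 1 :])"
  proof -
    have "?R = (\<Prod>j = 1..<n. smult 2 [: - c j, 1 :])"
      by (intro prod.cong) (auto simp: c_def)
    also have "\<dots> = smult (2 ^ card {1..<n}) (\<Prod>j = 1..<n. [: - c j, 1 :])"
      by (simp only: prod_smult prod_constant)
    finally show ?thesis by (simp only: n card_atLeastLessThan diff_Suc_1)
  qed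
  have lc: "coeff (\<Prod>j = 1..<n. [: - c j, 1 :]) k = 1" "degree (\<Prod>j = 1..<n. [: - c j, 1 :]) = k"
  proof -
    show d: "degree (\<Prod>j = 1..<n. [: - c j, 1 :]) = k"
      by (subst degree_prod_eq_sum_degree) (auto simp: n)
    show "coeff (\<Prod>j = 1..<n. [: - c j, 1 :]) k = 1"
      using lead_coeff_prod[of "\<lambda>j. [: - c j, 1 :]" "{1..<n}"] d by simp
  qed
  have root: "poly (cheb n - ?R) z = 0" if z: "z \<in> c ` {1..<n}" for z
  proof -
    obtain j where j: "j \<in> {1..<n}" "z = c j" using z by auto
    have "sin (real j / real n * pi) > 0"
      using j mult_strict_right_mono[of "real j / real n" 1 pi] by (intro sin_gt_zero) simp_all
    moreover have "sin (real n * (real j / real n * pi)) = 0"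
      using assms by (simp add: sin_npi)
    ultimately have "poly (cheb n) z = 0"
      using cheb_sin[of n "real j / real n * pi"] j by (auto simp: c_def)
    moreover have "poly ?R z = 0"
      unfolding R using j by (auto simp: poly_prod)
    ultimately show ?thesis by simp
  qed
  have dle: "degree (cheb n - ?R) \<le> k"
    using cheb_degree[of k] lc(2) unfolding R n[symmetric] by (intro degree_diff_le) auto
  have ck: "coeff (cheb n - ?R) k = 0"
    using cheb_degree[of k] lc unfolding R n[symmetric] by simp
  show ?thesis
  proof (rule ccontr)
    assume "cheb n \<noteq> ?R"
    then have nz: "cheb n - ?R \<noteq> 0" by simp
    have "degree (cheb n - ?R) \<noteq> k"
      using nz ck by (metis leading_coeff_0_iff)
    then have "degree (cheb n - ?R) < k" using dle by simp
    moreover have "k = card (c ` {1..<n})" using inj by (simp add: card_image n)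
    moreover have "card (c ` {1..<n}) \<le> card {z. poly (cheb n - ?R) z = 0}"
      using root nz by (intro card_mono poly_roots_finite) auto
    ultimately show False
      using card_poly_roots_bound[OF nz] by linarith
  qed
qed

lemma prod_fractions:
  fixes g :: "real \<Rightarrow> 'a :: comm_monoid_mult" and n :: nat
  assumes "n \<ge> 1"
  shows "(\<Prod>m | m dvd n. \<Prod>k\<in>totatives m. g (real k / real m)) = (\<Prod>j = 1..n. g (real j / real n))"
proof -
  have fin: "finite {m. m dvd n}" using assms by simp
  have "(\<Prod>m | m dvd n. \<Prod>k\<in>totatives m. g (real k / real m)) =
        (\<Prod>(m, k)\<in>Sigma {m. m dvd n} totatives. g (real k / real m))"
    using fin by (intro prod.Sigma) auto
  also have "\<dots> = (\<Prod>j = 1..n. g (real j / real n))"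
  proof (rule prod.reindex_bij_witness[where
        i = "\<lambda>j. (n div gcd j n, j div gcd j n)" and j = "\<lambda>(m, k). k * (n div m)"])
    fix a assume "a \<in> Sigma {m. m dvd n} totatives"
    then obtain m k where a: "a = (m, k)" "m dvd n" "0 < k" "k \<le> m" "coprime k m"
      by (auto simp: in_totatives_iff)
    obtain d where d: "n = m * d" using a by (auto elim: dvdE)
    have pos: "m > 0" "d > 0" using assms d by (auto intro: Nat.gr0I)
    have g: "gcd (k * d) (m * d) = d"
      using a(5) by (simp add: gcd_mult_right coprime_iff_gcd_eq_1 gcd_mult_distrib_nat[symmetric]
            mult.commute[of _ d])
    show "(n div gcd (case a of (m, k) \<Rightarrow> k * (n div m)) n,
           (case a of (m, k) \<Rightarrow> k * (n div m)) div gcd (case a of (m, k) \<Rightarrow> k * (n div m)) n) = a"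
      using a d pos g by simp
    show "(case a of (m, k) \<Rightarrow> k * (n div m)) \<in> {1..n}"
      using a d pos by simp
    show "g (real (case a of (m, k) \<Rightarrow> k * (n div m)) / real n) = (case a of (m, k) \<Rightarrow> g (real k / real m))"
      using a d pos by simp
  next
    fix j assume j: "j \<in> {1..n}"
    define d where "d = gcd j n"
    have dp: "d > 0" using j by (simp add: d_def)
    obtain m where m: "n = d * m" unfolding d_def by (meson dvdE gcd_dvd2)
    obtain k where k: "j = d * k" unfolding d_def by (meson dvdE gcd_dvd1)
    have mp: "m > 0" "k > 0" using m k j by (auto intro: Nat.gr0I)
    have "coprime k m"
      using dp m k d_def by (metis gcd_mult_distrib_nat coprime_iff_gcd_eq_1 mult_cancel1
            mult.right_neutral less_irrefl)
    moreover have "k \<le> m" using j m k dp by simp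
    ultimately show "(n div gcd j n, j div gcd j n) \<in> Sigma {m. m dvd n} totatives"
      using m k dp mp d_def[symmetric] by (simp add: in_totatives_iff)
    show "(case (n div gcd j n, j div gcd j n) of (m, k) \<Rightarrow> k * (n div m)) = j"
      using m k dp mp d_def[symmetric] by simp
  qed
  finally show ?thesis .
qed

lemma pell_v_new_exists:
  assumes "pell_solution D u v"
  shows "\<exists>w. \<forall>n\<ge>1. pell_v D u v n = (\<Prod>m | m dvd n. w m)"
proof -
  define g where "g r = (if r = 1 then v else pcompose [: of_real (- 2 * cos (r * pi)), 2 :] u)"
    for r :: real
  have "pell_v D u v n = (\<Prod>m | m dvd n. \<Prod>k\<in>totatives m. g (real k / real m))" if n: "n \<ge> 1" for n
  proof -
    have "pell_v D u v n = v * (\<Prod>j = 1..<n. pcompose [: of_real (- 2 * cos (real j / real n * pi)), 2 :] u)"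
      using n by (simp only: pell_v_cheb[OF assms] cheb_prod pcompose_prod)
    also have "\<dots> = g (real n / real n) * (\<Prod>j = 1..<n. g (real j / real n))"
      using n by (intro arg_cong2[where f = "(*)"] prod.cong) (auto simp: g_def)
    also have "\<dots> = (\<Prod>j\<in>insert n {1..<n}. g (real j / real n))"
      by simp
    also have "insert n {1..<n} = {1..n}" using n by auto
    finally show ?thesis using prod_fractions[OF n, of g] by simp
  qed
  then show ?thesis by blast
qed

lemma pell_v_nonzero:
  assumes "degree D > 0" "pell_solution D u v" "v \<noteq> 0" "n \<ge> 1"
  shows "pell_v D u v n \<noteq> 0"
proof -
  have u: "degree u \<noteq> 0"
  proof
    assume "degree u = 0"
    then have "degree (u\<^sup>2 - 1) = 0"
      by (metis degree_0_id degree_1 degree_diff_le degree_power_eq le_zero_eq mult_0_right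
          power2_eq_square degree_mult_le add_0)
    moreover have "D * v\<^sup>2 = u\<^sup>2 - 1"
      using assms(2) by (simp add: pell_solution_def algebra_simps)
    moreover have "degree (D * v\<^sup>2) \<ge> degree D"
      using assms by (subst degree_mult_eq) auto
    ultimately show False using assms(1) by simp
  qed
  obtain k where n: "n = Suc k" using assms by (cases n) auto
  have "cheb n \<noteq> 0" using cheb_degree[of k] by (auto simp: n)
  then show ?thesis
    using u assms(3) by (simp add: pell_v_cheb[OF assms(2)] pcompose_eq_0_iff)
qed

lemma pell_v_new_unique:
  assumes "degree D > 0" "pell_solution D u v" "v \<noteq> 0"
    and w: "\<And>n. n \<ge> 1 \<Longrightarrow> pell_v D u v n = (\<Prod>m | m dvd n. w m)"
    and w': "\<And>n. n \<ge> 1 \<Longrightarrow> pell_v D u v n = (\<Prod>m | m dvd n. w' m)"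
    and "n \<ge> 1"
  shows "w n = w' n"
  using \<open>n \<ge> 1\<close>
proof (induction n rule: less_induct)
  case (less n)
  let ?P = "{m. m dvd n} - {n}"
  have fin: "finite {m. m dvd n}" using less.prems by simp
  have "(\<Prod>m\<in>?P. w m) = (\<Prod>m\<in>?P. w' m)"
  proof (rule prod.cong[OF refl])
    fix m assume "m \<in> ?P"
    then have m: "m dvd n" "m \<noteq> n" by auto
    then have "m \<le> n" using less.prems by (intro dvd_imp_le) auto
    moreover have "m \<noteq> 0" using m less.prems by (intro notI) simp
    ultimately have "m < n" "m \<ge> 1" using m(2) by linarith+
    then show "w m = w' m" by (rule less.IH)
  qed
  moreover have "w n * (\<Prod>m\<in>?P. w m) = pell_v D u v n" "w' n * (\<Prod>m\<in>?P. w' m) = pell_v D u v n"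
    using w[OF less.prems] w'[OF less.prems] prod.remove[OF fin, of n w] prod.remove[OF fin, of n w']
    by simp_all
  moreover have "pell_v D u v n \<noteq> 0"
    using assms less.prems by (intro pell_v_nonzero) auto
  ultimately have "w n * (\<Prod>m\<in>?P. w m) = w' n * (\<Prod>m\<in>?P. w m)" "(\<Prod>m\<in>?P. w m) \<noteq> 0"
    by (metis mult_zero_right)+
  then show ?case
    by (simp only: mult_cancel_right simp_thms)
qed

lemma pell_v_new:
  assumes "degree D > 0" "pell_solution D u v" "v \<noteq> 0" "n \<ge> 1"
  shows "pell_v D u v n = (\<Prod>m | m dvd n. pell_v_new D u v m)"
proof -
  let ?Q = "\<lambda>w. w 0 = 0 \<and> (\<forall>n\<ge>1. pell_v D u v n = (\<Prod>m | m dvd n. w m))"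
  obtain w where w: "\<And>n. n \<ge> 1 \<Longrightarrow> pell_v D u v n = (\<Prod>m | m dvd n. w m)"
    using pell_v_new_exists[OF assms(2)] by auto
  have "?Q (w(0 := 0))"
  proof (intro conjI allI impI)
    fix n :: nat assume n: "n \<ge> 1"
    have "(\<Prod>m | m dvd n. (w(0 := 0)) m) = (\<Prod>m | m dvd n. w m)"
      using n by (intro prod.cong) auto
    then show "pell_v D u v n = (\<Prod>m | m dvd n. (w(0 := 0)) m)" using w[OF n] by simp
  qed simp
  moreover have "x = y" if "?Q x" "?Q y" for x y
  proof
    fix n show "x n = y n"
      using that pell_v_new_unique[OF assms(1-3), of x y n] by (cases "n = 0") auto
  qed
  ultimately have "\<exists>!w. ?Q w" by blast
  from theI'[OF this] show ?thesis
    unfolding pell_v_new_def[symmetric] using assms(4) by blast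
qed

lemma not_squarefree_iff_multiple_root:
  fixes p :: "complex poly"
  assumes "p \<noteq> 0"
  shows "\<not> squarefree p \<longleftrightarrow> (\<exists>z. order z p \<ge> 2)"
proof
  assume "\<not> squarefree p"
  then obtain q where q: "q\<^sup>2 dvd p" "\<not> q dvd 1" by (auto simp: squarefree_def)
  have "q \<noteq> 0" using q assms by auto
  then have "degree q \<noteq> 0" using q by (simp add: is_unit_iff_degree)
  then obtain z where "poly q z = 0"
    using fundamental_theorem_of_algebra_alt by (metis constant_degree fundamental_theorem_of_algebra)
  then have "[:- z, 1:]\<^sup>2 dvd q\<^sup>2" by (simp add: poly_eq_0_iff_dvd dvd_power_same)
  then have "[:- z, 1:]\<^sup>2 dvd p" using q(1) by (rule dvd_trans)
  then show "\<exists>z. order z p \<ge> 2" using assms order_divides by blast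
next
  assume "\<exists>z. order z p \<ge> 2"
  then obtain z where "[:- z, 1:]\<^sup>2 dvd p" using order_divides by blast
  moreover have "\<not> [:- z, 1:] dvd 1" by (simp add: is_unit_iff_degree)
  ultimately show "\<not> squarefree p" by (auto simp: squarefree_def)
qed

end

(* For n \<ge> 2 the new part of v_n is the product of the factors 2 u - 2 cos (k pi / n) over k coprime
   to n. Distinct factors have no common root, so a repeated root z of the product is a critical
   point of u. There are finitely many of these, and each determines the reduced fraction k / n,
   hence n, through u(z) = cos (k pi / n). *)
theory Submission
  imports Defs
begin

text \<open>If \<open>u\<close> were constant, so would be
  \<open>D * v\<^sup>2 = u\<^sup>2 - 1\<close>, whose degree is at least that of \<open>D\<close>.
  This makes \<open>pderiv u\<close> nonzero, so that \<open>u\<close> has finitely many critical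
  points.\<close>

lemma pell_solution_degree_pos:
  assumes "degree D > 0" "pell_solution D u v" "v \<noteq> 0"
  shows "degree u > 0"
proof (rule ccontr)
  assume "\<not> degree u > 0"
  then obtain c where u: "u = [:c:]"
    by (metis degree_eq_zeroE gr0I)
  have "D * v\<^sup>2 = u\<^sup>2 - 1"
    using assms(2) by (simp add: pell_solution_def algebra_simps)
  also have "\<dots> = [:c\<^sup>2 - 1:]"
    by (simp add: u power2_eq_square one_pCons)
  finally have "degree (D * v\<^sup>2) = 0" by simp
  moreover have "degree (D * v\<^sup>2) \<ge> degree D"
    using assms by (subst degree_mult_eq) auto
  ultimately show False using assms(1) by simp
qed

text \<open>The Chebyshev roots factor \<open>v_n\<close> over the fractions \<open>j/n\<close>.
  Sorting these by reduced denominator gives a factorization over the divisors of \<open>n\<close>,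
  and such a factorization is unique.\<close>

lemma pell_v_new_eq_prod_totatives:
  assumes "degree D > 0" "pell_solution D u v" "v \<noteq> 0" "n \<ge> 2"
  shows "pell_v_new D u v n =
    (\<Prod>k\<in>totatives n. pcompose [: of_real (- 2 * cos (real k / real n * pi)), 2 :] u)"
proof -
  \<comment> \<open>The value at 1 absorbs the extra factor \<open>v\<close> as the term
    \<open>j = n\<close>, so the product runs over all of \<open>1..n\<close>.\<close>
  define g where "g r = (if r = 1 then v else pcompose [: of_real (- 2 * cos (r * pi)), 2 :] u)"
    for r :: real
  have "pell_v D u v n = (\<Prod>m | m dvd n. \<Prod>k\<in>totatives m. g (real k / real m))"
    if n: "n \<ge> 1" for n
  proof -
    have "pell_v D u v n =
        v * (\<Prod>j = 1..<n. pcompose [: of_real (- 2 * cos (real j / real n * pi)), 2 :] u)"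
      using n by (simp only: pell_v_cheb[OF assms(2)] cheb_prod pcompose_prod)
    also have "\<dots> = g (real n / real n) * (\<Prod>j = 1..<n. g (real j / real n))"
      using n by (intro arg_cong2[where f = "(*)"] prod.cong) (auto simp: g_def)
    also have "\<dots> = (\<Prod>j\<in>insert n {1..<n}. g (real j / real n))"
      by simp
    also have "insert n {1..<n} = {1..n}" using n by auto
    finally show ?thesis using prod_fractions[OF n, of g] by simp
  qed
  from pell_v_new_unique[OF assms(1-3) pell_v_new[OF assms(1-3)] this]
  have "pell_v_new D u v n = (\<Prod>k\<in>totatives n. g (real k / real n))"
    using assms(4) by simp
  also have "\<dots> = (\<Prod>k\<in>totatives n. pcompose [: of_real (- 2 * cos (real k / real n * pi)), 2 :] u)"
  proof (rule prod.cong[OF refl])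
    fix k assume "k \<in> totatives n"
    \<comment> \<open>For \<open>n \<ge> 2\<close> the fraction \<open>k/n\<close> is never 1, so
      the exceptional value \<open>v\<close> of \<open>g\<close> does not occur.\<close>
    then have "k < n" using assms(4) by (simp add: totatives_less)
    then show "g (real k / real n) = pcompose [: of_real (- 2 * cos (real k / real n * pi)), 2 :] u"
      by (simp add: g_def)
  qed
  finally show ?thesis .
qed

text \<open>Cosine is injective on \<open>[0, pi]\<close>, and a positive fraction has only one
  reduced form. The case \<open>m = n\<close> separates the factors of one new part; the general
  case separates different indices.\<close>

lemma cos_fraction_inj:
  assumes "cos (real j / real m * pi) = cos (real k / real n * pi)"
    and "j \<in> totatives m" "k \<in> totatives n"
  shows "j = k \<and> m = n"
proof -
  have pos: "m > 0" "n > 0" "j \<le> m" "k \<le> n" and cop: "coprime j m" "coprime k n"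
    using assms(2,3) by (auto simp: in_totatives_iff)
  have "real j / real m * pi \<le> 1 * pi" "real k / real n * pi \<le> 1 * pi"
    using pos by (intro mult_right_mono; simp)+
  then have "real j / real m * pi = real k / real n * pi"
    using assms(1) cos_inj_pi[of "real j / real m * pi" "real k / real n * pi"] by simp
  then have "real (j * n) = real (k * m)"
    using pos by (simp add: field_simps)
  then have eq: "j * n = k * m"
    by (simp only: of_nat_eq_iff)
  have "j = k \<and> n = m"
    using coprime_crossproduct_nat[OF cop] eq by simp
  then show ?thesis by simp
qed

text \<open>Only one factor vanishes at \<open>z\<close>, so by the product rule the derivative of
  the product at \<open>z\<close> is that of this factor times a nonzero cofactor.\<close>

lemma double_root_prod:
  fixes f :: "'a \<Rightarrow> 'b :: idom poly"
  assumes "finite A" "[:- z, 1:]\<^sup>2 dvd prod f A"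
    and "\<And>i j. i \<in> A \<Longrightarrow> j \<in> A \<Longrightarrow> poly (f i) z = 0 \<Longrightarrow> poly (f j) z = 0 \<Longrightarrow> i = j"
  obtains i where "i \<in> A" "poly (f i) z = 0" "poly (pderiv (f i)) z = 0"
proof -
  obtain r where r: "prod f A = [:- z, 1:]\<^sup>2 * r"
    using assms(2) by (rule dvdE)
  have "poly (prod f A) z = 0" by (simp add: r)
  then obtain i where i: "i \<in> A" "poly (f i) z = 0"
    using assms(1) by (auto simp: poly_prod)
  have "poly (pderiv (prod f A)) z = 0"
    unfolding r power2_eq_square pderiv_mult poly_add poly_mult by simp
  moreover have "prod f A = f i * prod f (A - {i})"
    using assms(1) i(1) by (rule prod.remove)
  moreover have "poly (prod f (A - {i})) z \<noteq> 0"
    using assms(1,3) i by (auto simp: poly_prod)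
  ultimately have "poly (pderiv (f i)) z = 0"
    by (simp add: pderiv_mult i(2))
  with i show ?thesis by (rule that)
qed

lemma pell_v_new_multiple_root:
  assumes "degree D > 0" "pell_solution D u v" "v \<noteq> 0" "n \<ge> 2"
    and "\<not> squarefree (pell_v_new D u v n)"
  obtains z k where "poly (pderiv u) z = 0" "k \<in> totatives n"
    "poly u z = of_real (cos (real k / real n * pi))"
proof -
  let ?f = "\<lambda>k. pcompose [: complex_of_real (- 2 * cos (real k / real n * pi)), 2 :] u"
  have root: "poly (?f k) z = 0 \<longleftrightarrow> poly u z = of_real (cos (real k / real n * pi))" for k z
    by (simp add: poly_pcompose)
  have prod: "pell_v_new D u v n = prod ?f (totatives n)"
    by (rule pell_v_new_eq_prod_totatives[OF assms(1-4)])
  \<comment> \<open>The new part is nonzero because it is a factor of the nonzero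
    \<open>v_n\<close>; only then does failure of squarefreeness yield a root of order at least
    2.\<close>
  have "(\<Prod>m | m dvd n. pell_v_new D u v m) \<noteq> 0"
    using pell_v_new[OF assms(1-3), of n] pell_v_nonzero[OF assms(1-3), of n] assms(4) by simp
  then have "pell_v_new D u v n \<noteq> 0"
    using assms(4) by auto
  then obtain z where "order z (pell_v_new D u v n) \<ge> 2"
    using assms(5) not_squarefree_iff_multiple_root by blast
  then have "[:- z, 1:]\<^sup>2 dvd prod ?f (totatives n)"
    unfolding prod[symmetric] using order_divides by blast
  then obtain k where k: "k \<in> totatives n" "poly (?f k) z = 0" "poly (pderiv (?f k)) z = 0"
  proof (rule double_root_prod[rotated])
    fix i j assume "i \<in> totatives n" "j \<in> totatives n" "poly (?f i) z = 0" "poly (?f j) z = 0"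
    then show "i = j"
      unfolding root using cos_fraction_inj[of i n j n] by (metis of_real_eq_iff)
  qed auto
  \<comment> \<open>Each factor is \<open>2 * u\<close> minus a constant, so its derivative is
    \<open>2 * pderiv u\<close>.\<close>
  have "poly (pderiv u) z = 0"
    using k(3) by (simp add: pderiv_pcompose pderiv_pCons poly_pcompose)
  then show ?thesis
    using k(1) k(2)[unfolded root] by (rule that)
qed

theorem corollary2p4:
  fixes D u v :: "complex poly"
  assumes "degree D > 0"
    and "pellian D"
    and "pell_fundamental D u v"
  shows "finite {n::nat. n \<ge> 1 \<and> \<not> squarefree (pell_v_new D u v n)}"
proof -
  have sol: "pell_solution D u v" "v \<noteq> 0"
    using assms(3) by (auto simp: pell_fundamental_def)
  \<comment> \<open>\<open>N z\<close> holds the indices whose new part can vanish at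
    \<open>z\<close>, apart from index 1; it has at most one element.\<close>
  define N where "N z = {n. \<exists>k\<in>totatives n. poly u z = of_real (cos (real k / real n * pi))}" for z
  have "finite (N z)" for z
  proof (cases "N z = {}")
    case False
    then obtain n where n: "n \<in> N z" by blast
    then obtain k where k: "k \<in> totatives n" "poly u z = of_real (cos (real k / real n * pi))"
      unfolding N_def by blast
    have "m = n" if "m \<in> N z" for m
    proof -
      from that obtain j where "j \<in> totatives m" "poly u z = of_real (cos (real j / real m * pi))"
        unfolding N_def by blast
      then show ?thesis
        using k cos_fraction_inj[of j m k n] by (metis of_real_eq_iff)
    qed
    then have "N z \<subseteq> {n}" by blast
    then show ?thesis by (rule finite_subset) simp
  qed simp
  moreover have "pderiv u \<noteq> 0"
    using pell_solution_degree_pos[OF assms(1) sol] by (simp add: pderiv_eq_0_iff)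
  then have "finite {z. poly (pderiv u) z = 0}"
    by (rule poly_roots_finite)
  \<comment> \<open>Index 1 is set aside: its new part is \<open>v\<close> itself, which the product
    over totatives does not describe.\<close>
  ultimately have "finite (insert 1 (\<Union>z\<in>{z. poly (pderiv u) z = 0}. N z))"
    by blast
  moreover have "{n. n \<ge> 1 \<and> \<not> squarefree (pell_v_new D u v n)} \<subseteq>
      insert 1 (\<Union>z\<in>{z. poly (pderiv u) z = 0}. N z)"
  proof
    fix n assume n: "n \<in> {n. n \<ge> 1 \<and> \<not> squarefree (pell_v_new D u v n)}"
    show "n \<in> insert 1 (\<Union>z\<in>{z. poly (pderiv u) z = 0}. N z)"
    proof (cases "n = 1")
      case False
      with n have "n \<ge> 2" "\<not> squarefree (pell_v_new D u v n)" by auto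
      from pell_v_new_multiple_root[OF assms(1) sol this] show ?thesis
        unfolding N_def by blast
    qed simp
  qed
  ultimately show ?thesis by (rule rev_finite_subset)
qed

end
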